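(* Let $\mathbf{a}$ be a non-empty composition with binary word $\mathbf{w}(\mathbf{a})=\varepsilon_1\cdots\varepsilon_k$. Then $$\sigma(\mathbf{a})=\int_{\frac14>t_1>\cdots>t_k>0}\frac{f_{\varepsilon_1}(t_1)}{\sqrt{1-4t_1}}\,f_{\varepsilon_2}(t_2)\cdots f_{\varepsilon_k}(t_k)\,dt_1\cdots dt_k,$$ where $f_0(t)=1/t$ and $f_1(t)=1/(1-t)$.
   Context: A composition is a finite sequence $\mathbf{a}=(a_1,\ldots,a_r)$ of positive integers; its weight is $k=a_1+\cdots+a_r$. Its binary word is $\mathbf{w}(\mathbf{a})=0^{a_1-1}1\,0^{a_2-1}1\cdots0^{a_r-1}1$, where $0^u$ denotes $u$ consecutive zeros. For $r\geqslant 1$, $\sigma(\mathbf{a})=\sum_{n_1>\cdots>n_r>0}\binom{2n_1}{n_1}^{-1}n_1^{-a_1}\cdots n_r^{-a_r}$. *)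

theory Defs
  imports "HOL-Analysis.Analysis"
begin

definition composition :: "nat list \<Rightarrow> bool" where
  "composition a \<longleftrightarrow> (\<forall>x\<in>set a. 0 < x)"

definition weight :: "nat list \<Rightarrow> nat" where
  "weight a = sum_list a"

definition binary_word :: "nat list \<Rightarrow> nat list" where
  "binary_word a = concat (map (\<lambda>x. replicate (x - 1) 0 @ [1]) a)"

lemma length_binary_word: "composition a \<Longrightarrow> length (binary_word a) = weight a"
  by (induction a) (auto simp: composition_def weight_def binary_word_def)

lemma set_binary_word: "set (binary_word a) \<subseteq> {0, 1}"
  by (auto simp: binary_word_def)

text \<open>Tuples are 0-based: \<open>n\<^sub>1 > \<dots> > n\<^sub>r > 0\<close> is the list \<open>[n\<^sub>1, \<dots>, n\<^sub>r]\<close>.\<close>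

definition decreasing_tuples :: "nat \<Rightarrow> nat list set" where
  "decreasing_tuples r = {n. length n = r \<and> sorted_wrt (>) n \<and> (\<forall>x\<in>set n. 0 < x)}"

definition sigma_summand :: "nat list \<Rightarrow> nat list \<Rightarrow> real" where
  "sigma_summand a n =
     inverse (real ((2 * n ! 0) choose (n ! 0))) * (\<Prod>i<length a. inverse (real (n ! i) ^ (a ! i)))"

definition comp_sigma :: "nat list \<Rightarrow> real" where
  "comp_sigma a = (\<Sum>\<^sub>\<infinity>n\<in>decreasing_tuples (length a). sigma_summand a n)"

definition f_letter :: "nat \<Rightarrow> real \<Rightarrow> real" where
  "f_letter e t = (if e = 0 then 1 / t else 1 / (1 - t))"

text \<open>Points of \<open>\<real>\<^sup>k\<close> are elements \<open>t\<close> of the product space over the index set \<open>{..<k}\<close>;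
  the coordinate \<open>t\<^sub>i\<close> is \<open>t (i - 1)\<close>.\<close>

definition lborel_pow :: "nat \<Rightarrow> (nat \<Rightarrow> real) measure" where
  "lborel_pow k = (\<Pi>\<^sub>M i\<in>{..<k}. lborel)"

definition simplex_quarter :: "nat \<Rightarrow> (nat \<Rightarrow> real) set" where
  "simplex_quarter k = {t \<in> space (lborel_pow k).
     (\<forall>i<k. 0 < t i \<and> t i < 1/4) \<and> (\<forall>i j. i < j \<longrightarrow> j < k \<longrightarrow> t j < t i)}"

definition sigma_integrand :: "nat list \<Rightarrow> (nat \<Rightarrow> real) \<Rightarrow> real" where
  "sigma_integrand w t =
     f_letter (w ! 0) (t 0) / sqrt (1 - 4 * t 0) * (\<Prod>i\<in>{1..<length w}. f_letter (w ! i) (t i))"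

end

theory Submission
  imports Defs
begin

text \<open>
  All integrands are nonnegative, so by Tonelli the integral over the simplex can be done one
  variable at a time, starting from \<open>t\<^sub>k\<close>. Each inner integral is a power series in the next
  variable: multiplication by \<open>1/t\<close> shifts the coefficients, multiplication by \<open>1/(1 - t)\<close> takes
  their partial sums, and integration divides the coefficient of \<open>t\<^sup>n\<close> by \<open>n\<close>. Thus the coefficients
  of the word of \<open>a\<close> are the nested sums with fixed \<open>n\<^sub>1\<close>. The weight in the outermost variable
  turns \<open>t\<^bsup>n-1\<^esup>\<close> into the Beta integral
  \<open>\<integral> t\<^bsup>n-1\<^esup> / sqrt (1 - 4t) dt = 4\<^bsup>-n\<^esup> B(n, 1/2) = 1 / (n \<cdot> (2n choose n))\<close> over \<open>(0, 1/4)\<close>.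
  Convergence holds because all coefficients lie in \<open>[0, 1]\<close>.
\<close>

section \<open>Iterated integrals\<close>

text \<open>The head of the list belongs to the outermost, largest variable, just as the first
  letter of a word does. Values in \<open>ennreal\<close> allow Tonelli before any convergence is
  known.\<close>

fun iter_int :: "(real \<Rightarrow> real) list \<Rightarrow> real \<Rightarrow> ennreal" where
  "iter_int [] x = 1"
| "iter_int (g # gs) x =
     (\<integral>\<^sup>+ y. ennreal (indicator {0<..<x} y * g y) * iter_int gs y \<partial>lborel)"

text \<open>A general index set \<open>I\<close> lets coordinates be peeled off from the front
  without renumbering the remaining ones.\<close>

definition decreasing_below :: "nat set \<Rightarrow> real \<Rightarrow> (nat \<Rightarrow> real) \<Rightarrow> bool" where
  "decreasing_below I x t \<longleftrightarrow>
     (\<forall>i\<in>I. 0 < t i \<and> t i < x) \<and> (\<forall>i\<in>I. \<forall>j\<in>I. i < j \<longrightarrow> t j < t i)"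

text \<open>The smallest index carries the largest coordinate, so \<open>y\<close> takes over from
  \<open>x\<close> as the upper bound for all the others; their bound by \<open>x\<close> then
  follows by transitivity.\<close>

lemma decreasing_below_insert:
  assumes "\<And>i. i \<in> I \<Longrightarrow> j < i"
  shows "decreasing_below (insert j I) x (t(j := y)) \<longleftrightarrow> 0 < y \<and> y < x \<and> decreasing_below I y t"
proof -
  have neq: "i \<noteq> j" and order: "j < i" "\<not> i < j" if "i \<in> I" for i
    using assms[OF that] by auto
  have "decreasing_below (insert j I) x (t(j := y)) \<longleftrightarrow>
      (0 < y \<and> y < x \<and> (\<forall>i\<in>I. 0 < t i \<and> t i < x)) \<and>
      (\<forall>i\<in>I. t i < y) \<and> (\<forall>i\<in>I. \<forall>k\<in>I. i < k \<longrightarrow> t k < t i)"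
    unfolding decreasing_below_def by (simp add: neq order cong: ball_cong)
  moreover have "t i < x" if "t i < y" "y < x" for i
    using that by (rule less_trans)
  ultimately show ?thesis
    unfolding decreasing_below_def by blast
qed

lemma decreasing_below_measurable [measurable]:
  assumes "finite I"
  shows "Measurable.pred (\<Pi>\<^sub>M i\<in>I. lborel) (decreasing_below I x)"
proof -
  have [measurable]: "(\<lambda>t. t i :: real) \<in> borel_measurable (\<Pi>\<^sub>M i\<in>I. lborel)" if "i \<in> I" for i
    using measurable_component_singleton[OF that, of "\<lambda>_. lborel :: real measure"] by simp
  note [simp] = assms countable_finite
  show ?thesis
    unfolding decreasing_below_def [abs_def] by measurable
qed

text \<open>Downward induction on \<open>j\<close>: with coordinate \<open>j\<close> fixed at
  \<open>y\<close>, the remaining integral is the same one for \<open>Suc j\<close> with upper limit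
  \<open>y\<close>. Hence \<open>x\<close> varies in the induction, while the fixed \<open>b\<close>
  delimits where the factors are nonnegative.\<close>

lemma nn_integral_simplex_eq_iter_int:
  assumes gs: "\<And>g. g \<in> set gs \<Longrightarrow> g \<in> borel_measurable borel"
    and "j \<le> length gs"
    and nonneg: "\<And>g y. g \<in> set gs \<Longrightarrow> 0 < y \<Longrightarrow> y < b \<Longrightarrow> 0 \<le> g y"
    and "x \<le> b"
  shows "(\<integral>\<^sup>+ t. ennreal (of_bool (decreasing_below {j..<length gs} x t) *
            (\<Prod>i\<in>{j..<length gs}. (gs ! i) (t i))) \<partial>(\<Pi>\<^sub>M i\<in>{j..<length gs}. lborel))
         = iter_int (drop j gs) x"
  using assms(2,4)
proof (induction arbitrary: x rule: inc_induct)
  case base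
  have "decreasing_below {} x t" for t
    by (simp add: decreasing_below_def)
  then show ?case
    by (simp add: PiM_empty nn_integral_count_space_finite)
next
  case (step j)
  let ?k = "length gs"
  define I where "I = {Suc j..<?k}"
  have I: "{j..<?k} = insert j I" "finite I" "j \<notin> I" "\<And>i. i \<in> I \<Longrightarrow> j < i"
    using step.hyps by (auto simp: I_def)
  interpret product_sigma_finite "\<lambda>_. lborel :: real measure"
    by standard
  have [measurable]: "gs ! i \<in> borel_measurable borel" if "i \<in> insert j I" for i
    using that step.hyps by (intro gs nth_mem) (auto simp: I_def)
  have comp [measurable]: "(\<lambda>t. t i :: real) \<in> borel_measurable (\<Pi>\<^sub>M i\<in>J. lborel)" if "i \<in> J" for i J
    using measurable_component_singleton[OF that, of "\<lambda>_. lborel :: real measure"] by simp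
  have prod [measurable]: "(\<lambda>t. \<Prod>i\<in>J. (gs ! i) (t i)) \<in> borel_measurable (\<Pi>\<^sub>M i\<in>J. lborel)"
    if "J \<subseteq> insert j I" for J
    using that by (intro borel_measurable_prod measurable_compose[OF comp]) auto
  have gj: "0 \<le> (gs ! j) y" if "0 < y" "y < x" for y
    using that step.hyps step.prems by (intro nonneg nth_mem) auto
  have meas: "(\<lambda>t. ennreal (of_bool (decreasing_below J y t) * (\<Prod>i\<in>J. (gs ! i) (t i))))
      \<in> borel_measurable (\<Pi>\<^sub>M i\<in>J. lborel)" if "J \<subseteq> insert j I" for J y
  proof -
    have [measurable]: "Measurable.pred (\<Pi>\<^sub>M i\<in>J. lborel) (decreasing_below J y)"
      using that I(2) by (intro decreasing_below_measurable) (auto intro: finite_subset)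
    show ?thesis using prod[OF that] by measurable
  qed
  \<comment> \<open>Tonelli, with coordinate \<open>j\<close> as the outer variable.\<close>
  have "(\<integral>\<^sup>+ t. ennreal (of_bool (decreasing_below {j..<?k} x t) *
            (\<Prod>i\<in>{j..<?k}. (gs ! i) (t i))) \<partial>(\<Pi>\<^sub>M i\<in>{j..<?k}. lborel))
     = (\<integral>\<^sup>+ y. \<integral>\<^sup>+ t. ennreal (of_bool (decreasing_below (insert j I) x (t(j := y))) *
            (\<Prod>i\<in>insert j I. (gs ! i) ((t(j := y)) i))) \<partial>(\<Pi>\<^sub>M i\<in>I. lborel) \<partial>lborel)"
    unfolding I(1) by (rule product_nn_integral_insert_rev[OF I(2,3) meas[OF subset_refl]])
  also have "\<dots> = (\<integral>\<^sup>+ y. ennreal (indicator {0<..<x} y * (gs ! j) y) *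
       iter_int (drop (Suc j) gs) y \<partial>lborel)"
  proof (rule nn_integral_cong)
    fix y :: real
    show "(\<integral>\<^sup>+ t. ennreal (of_bool (decreasing_below (insert j I) x (t(j := y))) *
            (\<Prod>i\<in>insert j I. (gs ! i) ((t(j := y)) i))) \<partial>(\<Pi>\<^sub>M i\<in>I. lborel))
        = ennreal (indicator {0<..<x} y * (gs ! j) y) * iter_int (drop (Suc j) gs) y"
    proof (cases "y \<in> {0<..<x}")
      case False
      then have "\<not> decreasing_below (insert j I) x (t(j := y))" for t
        by (auto simp: decreasing_below_insert[OF I(4)])
      then show ?thesis using False by simp
    next
      case True
      have "(\<Prod>i\<in>insert j I. (gs ! i) ((t(j := y)) i)) = (gs ! j) y * (\<Prod>i\<in>I. (gs ! i) (t i))" for t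
        using I(2,3) by (subst prod.insert) (auto intro!: prod.cong)
      \<comment> \<open>Nonnegativity of the factor at \<open>y\<close> allows it to leave
        \<open>ennreal\<close> as a separate factor, constant for the inner integral.\<close>
      then have "ennreal (of_bool (decreasing_below (insert j I) x (t(j := y))) *
            (\<Prod>i\<in>insert j I. (gs ! i) ((t(j := y)) i)))
          = ennreal ((gs ! j) y) * ennreal (of_bool (decreasing_below I y t) * (\<Prod>i\<in>I. (gs ! i) (t i)))" for t
        using True gj[of y] by (simp add: decreasing_below_insert[OF I(4)] ennreal_mult' [symmetric] mult_ac)
      then have "(\<integral>\<^sup>+ t. ennreal (of_bool (decreasing_below (insert j I) x (t(j := y))) *
            (\<Prod>i\<in>insert j I. (gs ! i) ((t(j := y)) i))) \<partial>(\<Pi>\<^sub>M i\<in>I. lborel))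
          = (\<integral>\<^sup>+ t. ennreal ((gs ! j) y) * ennreal (of_bool (decreasing_below I y t) *
              (\<Prod>i\<in>I. (gs ! i) (t i))) \<partial>(\<Pi>\<^sub>M i\<in>I. lborel))"
        by (simp only:)
      also have "\<dots> = ennreal ((gs ! j) y) * iter_int (drop (Suc j) gs) y"
        unfolding nn_integral_cmult[OF meas[OF subset_insertI]]
        using True step.IH[of y] step.prems by (simp flip: I_def)
      finally show ?thesis using True by simp
    qed
  qed
  also have "\<dots> = iter_int (drop j gs) x"
    using step.hyps by (simp flip: Cons_nth_drop_Suc)
  finally show ?case .
qed

section \<open>Power series of iterated integrals\<close>

text \<open>\<open>K n\<close> is the \<open>n\<close>-th moment of the weight \<open>h\<close>. All
  terms are nonnegative, so series and integral may be exchanged in \<open>ennreal\<close>; the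
  summability hypotheses serve to pass between real and \<open>ennreal\<close> series.\<close>

lemma nn_integral_powser:
  assumes [measurable]: "h \<in> borel_measurable borel"
    and h: "\<And>t. t \<in> {0<..<x} \<Longrightarrow> 0 \<le> h t"
    and K: "\<And>n. (\<integral>\<^sup>+ t. ennreal (indicator {0<..<x} t * (h t * t ^ n)) \<partial>lborel) = ennreal (K n)"
    and d: "\<And>n. 0 \<le> d n" and K0: "\<And>n. 0 \<le> K n"
    and summ: "\<And>t. t \<in> {0<..<x} \<Longrightarrow> summable (\<lambda>n. d n * t ^ n)"
    and summK: "summable (\<lambda>n. d n * K n)"
  shows "(\<integral>\<^sup>+ t. ennreal (indicator {0<..<x} t * (h t * (\<Sum>n. d n * t ^ n))) \<partial>lborel)
    = ennreal (\<Sum>n. d n * K n)"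
proof -
  have "ennreal (indicator {0<..<x} t * (h t * (\<Sum>n. d n * t ^ n)))
     = (\<Sum>n. ennreal (d n) * ennreal (indicator {0<..<x} t * (h t * t ^ n)))" for t
  proof (cases "t \<in> {0<..<x}")
    case True
    have "(\<Sum>n. ennreal (d n) * ennreal (indicator {0<..<x} t * (h t * t ^ n)))
        = (\<Sum>n. ennreal (h t * (d n * t ^ n)))"
      using True d by (simp add: ennreal_mult' [symmetric] mult_ac)
    also have "\<dots> = ennreal (\<Sum>n. h t * (d n * t ^ n))"
      using True d h[OF True] summable_mult[OF summ[OF True], of "h t"] by (intro suminf_ennreal2) auto
    finally show ?thesis
      using True summ[OF True] by (simp add: suminf_mult)
  qed simp
  then have "(\<integral>\<^sup>+ t. ennreal (indicator {0<..<x} t * (h t * (\<Sum>n. d n * t ^ n))) \<partial>lborel)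
     = (\<Sum>n. ennreal (d n * K n))"
    by (simp add: nn_integral_suminf nn_integral_cmult K ennreal_mult d K0)
  also have "\<dots> = ennreal (\<Sum>n. d n * K n)"
    using d K0 summK by (intro suminf_ennreal2) auto
  finally show ?thesis .
qed

lemma nn_integral_power_Ioo:
  assumes "0 \<le> x"
  shows "(\<integral>\<^sup>+ t. ennreal (indicator {0<..<x} t * t ^ n) \<partial>lborel) = ennreal (x ^ Suc n / real (Suc n))"
proof (rule nn_integral_has_integral_lborel)
  have "((\<lambda>t. t ^ n) has_integral (x ^ Suc n / real (Suc n) - 0 ^ Suc n / real (Suc n))) {0..x}"
    using assms
    by (intro fundamental_theorem_of_calculus)
       (auto intro!: derivative_eq_intros
          simp: has_real_derivative_iff_has_vector_derivative [symmetric] simp del: of_nat_Suc power_Suc)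
  then have "((\<lambda>t. t ^ n) has_integral (x ^ Suc n / real (Suc n))) {0<..<x}"
    by (simp add: has_integral_Icc_iff_Ioo)
  then show "((\<lambda>t. indicator {0<..<x} t * t ^ n) has_integral (x ^ Suc n / real (Suc n))) UNIV"
    by (subst (asm) has_integral_restrict_UNIV [symmetric]) (simp add: indicator_def of_bool_def if_distribR if_distrib cong: if_cong)
qed (auto simp: indicator_def)

text \<open>Coefficients of the iterated integral of a word as a power series in its upper limit;
  since \<open>x / 0 = 0\<close>, the constant coefficient vanishes for nonempty words.\<close>

fun word_coeff :: "nat list \<Rightarrow> nat \<Rightarrow> real" where
  "word_coeff [] n = of_bool (n = 0)"
| "word_coeff (e # w) n =
     (if e = 0 then word_coeff w n else (\<Sum>m<n. word_coeff w m)) / real n"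

lemma word_coeff_nonneg: "0 \<le> word_coeff w n"
  by (induction w arbitrary: n) (auto intro!: divide_nonneg_nonneg sum_nonneg)

text \<open>Letter 1 takes the average of \<open>n\<close> earlier coefficients and letter 0 divides
  one coefficient by \<open>n\<close>, so the bound 1 is inherited. It reduces all later convergence
  questions to geometric series.\<close>

lemma word_coeff_le_1: "word_coeff w n \<le> 1"
proof (induction w arbitrary: n)
  case (Cons e w)
  show ?case
  proof (cases "n = 0")
    case False
    have "(\<Sum>m<n. word_coeff w m) \<le> (\<Sum>m<n. 1)"
      by (intro sum_mono Cons)
    moreover have "word_coeff w n \<le> real n"
      using Cons[of n] False by linarith
    ultimately show ?thesis using False by (simp add: divide_le_eq)
  qed simp
qed simp

lemma summable_word_coeff:
  assumes "0 \<le> x" "x < 1"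
  shows "summable (\<lambda>n. word_coeff w n * x ^ n)"
  by (rule summable_comparison_test[OF _ summable_geometric[of x]])
     (use assms in \<open>auto simp: abs_mult word_coeff_nonneg intro!: exI[of _ 0] mult_left_le_one_le word_coeff_le_1\<close>)

text \<open>Exactly the words whose iterated integral converges at \<open>0\<close>.\<close>

fun ends_in_one :: "nat list \<Rightarrow> bool" where
  "ends_in_one [] \<longleftrightarrow> True"
| "ends_in_one (e # w) \<longleftrightarrow> (e = 0 \<longrightarrow> w \<noteq> []) \<and> ends_in_one w"

text \<open>The series on the left is the termwise derivative of the one for \<open>e # w\<close>:
  the factor \<open>Suc n\<close> undoes the division in \<open>word_coeff\<close>. For letter 0,
  the constant term of a nonempty \<open>w\<close> vanishes, so dividing by \<open>t\<close> shifts
  the series; for letter 1, the Cauchy product with the geometric series produces the partial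
  sums.\<close>

lemma f_letter_times_powser:
  assumes "e = 0 \<longrightarrow> w \<noteq> []" "0 < t" "t < 1"
  shows "(\<lambda>n. real (Suc n) * word_coeff (e # w) (Suc n) * t ^ n) sums
           (f_letter e t * (\<Sum>n. word_coeff w n * t ^ n))"
proof (cases "e = 0")
  case True
  then obtain e' w' where w: "w = e' # w'"
    using assms(1) by (cases w) auto
  have "(\<lambda>n. word_coeff w n * t ^ n) sums (\<Sum>n. word_coeff w n * t ^ n)"
    using assms by (intro summable_sums summable_word_coeff) auto
  then have "(\<lambda>n. word_coeff w (Suc n) * t ^ Suc n) sums (\<Sum>n. word_coeff w n * t ^ n)"
    by (subst sums_Suc_iff) (simp add: w)
  then have "(\<lambda>n. 1 / t * (word_coeff w (Suc n) * t ^ Suc n)) sums (1 / t * (\<Sum>n. word_coeff w n * t ^ n))"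
    by (rule sums_mult)
  then show ?thesis
    using True assms by (simp add: f_letter_def)
next
  case False
  have s: "summable (\<lambda>n. norm (word_coeff w n * t ^ n))"
    using summable_word_coeff[of t w] assms by (simp add: abs_mult word_coeff_nonneg)
  have "(\<lambda>n. \<Sum>i\<le>n. (word_coeff w i * t ^ i) * t ^ (n - i)) sums
      ((\<Sum>n. word_coeff w n * t ^ n) * (\<Sum>n. t ^ n))"
    using assms by (intro Cauchy_product_sums s) (simp add: summable_geometric)
  moreover have "(\<Sum>i\<le>n. (word_coeff w i * t ^ i) * t ^ (n - i)) =
      real (Suc n) * word_coeff (e # w) (Suc n) * t ^ n" for n
  proof -
    have "(\<Sum>i\<le>n. (word_coeff w i * t ^ i) * t ^ (n - i)) = (\<Sum>i\<le>n. word_coeff w i * t ^ n)"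
      by (intro sum.cong) (simp_all add: mult.assoc flip: power_add)
    then show ?thesis
      using False by (simp add: sum_distrib_right lessThan_Suc_atMost del: of_nat_Suc)
  qed
  ultimately show ?thesis
    using False assms by (simp add: f_letter_def suminf_geometric mult.commute)
qed

lemma f_letter_measurable [measurable]: "f_letter e \<in> borel_measurable borel"
  unfolding f_letter_def [abs_def] by measurable

lemma f_letter_nonneg: "0 < t \<Longrightarrow> t < 1 \<Longrightarrow> 0 \<le> f_letter e t"
  by (simp add: f_letter_def)

text \<open>One integration step, stated for a weight \<open>h\<close> so that it covers both uses:
  \<open>h = 1\<close> with \<open>K n = x ^ n\<close> for plain letters, and the inverse square
  root with inverse central binomials for the outermost one. Writing the moments as
  \<open>K (Suc n) / real (Suc n)\<close> cancels the factor from
  \<open>f_letter_times_powser\<close>.\<close>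

lemma iter_int_weighted_letter:
  assumes h [measurable]: "h \<in> borel_measurable borel"
    and "\<And>t. t \<in> {0<..<x} \<Longrightarrow> 0 \<le> h t"
    and "\<And>n. (\<integral>\<^sup>+ t. ennreal (indicator {0<..<x} t * (h t * t ^ n)) \<partial>lborel) = ennreal (K (Suc n) / real (Suc n))"
    and K0: "\<And>n. 0 \<le> K n"
    and "x < 1" and ew: "e = 0 \<longrightarrow> w \<noteq> []"
    and w: "\<And>t. t \<in> {0<..<x} \<Longrightarrow> iter_int (map f_letter w) t = ennreal (\<Sum>n. word_coeff w n * t ^ n)"
    and summK: "summable (\<lambda>n. word_coeff (e # w) n * K n)"
  shows "iter_int ((\<lambda>t. h t * f_letter e t) # map f_letter w) x
    = ennreal (\<Sum>n. word_coeff (e # w) n * K n)"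
proof -
  define d where "d n = real (Suc n) * word_coeff (e # w) (Suc n)" for n
  have d0: "0 \<le> d n" for n
    unfolding d_def by (intro mult_nonneg_nonneg word_coeff_nonneg) simp
  have sums: "(\<lambda>n. d n * t ^ n) sums (f_letter e t * (\<Sum>n. word_coeff w n * t ^ n))"
    if "t \<in> {0<..<x}" for t
    unfolding d_def using that \<open>x < 1\<close> by (intro f_letter_times_powser ew) auto
  have dK: "d n * (K (Suc n) / real (Suc n)) = word_coeff (e # w) (Suc n) * K (Suc n)" for n
    unfolding d_def by (simp del: of_nat_Suc word_coeff.simps)
  have "iter_int ((\<lambda>t. h t * f_letter e t) # map f_letter w) x
     = (\<integral>\<^sup>+ t. ennreal (indicator {0<..<x} t * (h t * (\<Sum>n. d n * t ^ n))) \<partial>lborel)"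
    unfolding iter_int.simps
  proof (rule nn_integral_cong)
    fix t :: real
    show "ennreal (indicator {0<..<x} t * (h t * f_letter e t)) * iter_int (map f_letter w) t
      = ennreal (indicator {0<..<x} t * (h t * (\<Sum>n. d n * t ^ n)))"
    proof (cases "t \<in> {0<..<x}")
      case True
      have "0 \<le> (\<Sum>n. word_coeff w n * t ^ n)"
        using True \<open>x < 1\<close> by (intro suminf_nonneg summable_word_coeff mult_nonneg_nonneg word_coeff_nonneg) auto
      then show ?thesis
        using True sums_unique[OF sums[OF True]] w[OF True]
        by (simp add: ennreal_mult'' [symmetric] mult_ac)
    qed simp
  qed
  also have "\<dots> = ennreal (\<Sum>n. d n * (K (Suc n) / real (Suc n)))"
  proof (intro nn_integral_powser h)
    show "summable (\<lambda>n. d n * (K (Suc n) / real (Suc n)))"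
      unfolding dK using summK by (rule summable_ignore_initial_segment[where k = 1, simplified])
  qed (use assms(2,3) d0 sums K0 in \<open>auto simp: sums_iff simp del: of_nat_Suc\<close>)
  \<comment> \<open>The index shift loses nothing: \<open>word_coeff (e # w) 0\<close> is a division
    by zero, hence 0.\<close>
  also have "(\<Sum>n. d n * (K (Suc n) / real (Suc n))) = (\<Sum>n. word_coeff (e # w) n * K n)"
    unfolding dK using suminf_split_head[OF summK] by simp
  finally show ?thesis .
qed

lemma iter_int_letters:
  assumes "ends_in_one w" "0 \<le> x" "x < 1"
  shows "iter_int (map f_letter w) x = ennreal (\<Sum>n. word_coeff w n * x ^ n)"
  using assms
proof (induction w arbitrary: x)
  case Nil
  have "(\<lambda>n. word_coeff [] n * x ^ n) sums (word_coeff [] 0 * x ^ 0)"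
    by (rule sums_finite[of "{0}", simplified]) auto
  then show ?case by (simp add: sums_iff)
next
  case (Cons e w)
  have "iter_int ((\<lambda>t. 1 * f_letter e t) # map f_letter w) x
    = ennreal (\<Sum>n. word_coeff (e # w) n * x ^ n)"
    using Cons.prems nn_integral_power_Ioo[of x] summable_word_coeff[of x "e # w"]
    by (intro iter_int_weighted_letter Cons.IH) (auto simp del: word_coeff.simps)
  then show ?case by simp
qed

section \<open>The central binomial weight\<close>

text \<open>Both sides obey the same recurrence: passing from \<open>n\<close> to
  \<open>n + 1\<close> multiplies them by \<open>(n + 1) / (n + 3/2)\<close>, and both start at
  2.\<close>

lemma Beta_half_central_binomial:
  "Beta (real n + 1) (1/2) = 4 ^ Suc n / (real (Suc n) * real ((2 * Suc n) choose Suc n))"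
proof (induction n)
  case 0
  have "Beta 1 (1/2 :: real) = 2"
  proof -
    have "(1/2 :: real) \<notin> \<int>\<^sub>\<le>\<^sub>0"
      using nonpos_Ints_nonpos[of "1/2 :: real"] by auto
    then have Gamma_3_2: "Gamma (3/2 :: real) = 1/2 * sqrt pi"
      using Gamma_plus1[of "1/2 :: real"] by (simp add: Gamma_one_half_real)
    show ?thesis
      by (simp add: Beta_def Gamma_one_half_real Gamma_3_2)
  qed
  then show ?case by simp
next
  case (Suc n)
  have nz: "real n + 1 \<notin> \<int>\<^sub>\<le>\<^sub>0"
    using nonpos_Ints_nonpos[of "real n + 1"] by auto
  have rec: "(real n + 3/2) * Beta (real (Suc n) + 1) (1/2) = (real n + 1) * Beta (real n + 1) (1/2)"
    using Beta_plus1_left[OF nz, of "1/2"] by (simp add: add_ac)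
  \<comment> \<open>The ratio of consecutive central binomials, by two absorption identities through
    the intermediate \<open>(2 * Suc n + 1) choose Suc n\<close>.\<close>
  have choose: "(real n + 2) * real ((2 * Suc (Suc n)) choose Suc (Suc n))
      = 2 * (2 * real n + 3) * real ((2 * Suc n) choose Suc n)"
  proof -
    have "Suc (Suc n) * ((2 * Suc (Suc n)) choose Suc (Suc n)) = 2 * Suc (Suc n) * ((2 * Suc n + 1) choose Suc n)"
      using Suc_times_binomial_eq[of "2 * Suc n + 1" "Suc n"] by (simp add: mult.commute)
    then have 1: "((2 * Suc (Suc n)) choose Suc (Suc n)) = 2 * ((2 * Suc n + 1) choose Suc n)"
      by (simp del: mult_Suc mult_Suc_right binomial_Suc_Suc add: mult.assoc mult.left_commute[of 2])
    have 2: "Suc (Suc n) * ((2 * Suc n + 1) choose Suc n) = (2 * Suc n + 1) * ((2 * Suc n) choose Suc n)"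
      using binomial_absorb_comp[of "2 * Suc n + 1" "Suc n"] by simp
    have "Suc (Suc n) * ((2 * Suc (Suc n)) choose Suc (Suc n)) = 2 * ((2 * Suc n + 1) * ((2 * Suc n) choose Suc n))"
      unfolding 1 2 [symmetric] by simp
    then have "real (Suc (Suc n) * ((2 * Suc (Suc n)) choose Suc (Suc n))) = real (2 * ((2 * Suc n + 1) * ((2 * Suc n) choose Suc n)))"
      by (rule arg_cong)
    then show ?thesis by (simp add: algebra_simps del: binomial_Suc_Suc)
  qed
  define c c' where "c = real ((2 * Suc n) choose Suc n)" and "c' = real ((2 * Suc (Suc n)) choose Suc (Suc n))"
  have "Beta (real (Suc n) + 1) (1/2) = (real n + 1) * (4 ^ Suc n / (real (Suc n) * c)) / (real n + 3/2)"
  proof (rule eq_divide_imp)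
    show "real n + 3/2 \<noteq> 0"
      using of_nat_0_le_iff[of n, where 'a = real] by linarith
    show "Beta (real (Suc n) + 1) (1/2) * (real n + 3/2) = (real n + 1) * (4 ^ Suc n / (real (Suc n) * c))"
      using rec unfolding Suc.IH c_def [symmetric] by (simp only: mult.commute)
  qed
  also have "\<dots> = 4 ^ Suc n / (c * (real n + 3/2))"
    by (simp add: add.commute)
  also have "\<dots> = 4 ^ Suc (Suc n) / (real (Suc (Suc n)) * c')"
  proof -
    have "real (Suc (Suc n)) * c' = 4 * (c * (real n + 3/2))"
      using choose by (fold c_def c'_def) (simp add: algebra_simps)
    then show ?thesis by simp
  qed
  finally show ?case unfolding c'_def .
qed

lemma nn_integral_central_binomial_weight:
  "(\<integral>\<^sup>+ t. ennreal (indicator {0<..<1/4} t * (1 / sqrt (1 - 4 * t) * t ^ n)) \<partial>lborel)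
     = ennreal (inverse (real ((2 * Suc n) choose Suc n)) / real (Suc n))"
proof -
  \<comment> \<open>Substituting \<open>t = u / 4\<close> moves the singularity of the weight to 1
    and the domain to the unit interval.\<close>
  have "(\<integral>\<^sup>+ t. ennreal (indicator {0<..<1/4} t * (1 / sqrt (1 - 4 * t) * t ^ n)) \<partial>lborel)
     = ennreal (1/4) * (\<integral>\<^sup>+ u. ennreal (indicator {0<..<1/4} (u / 4) * (1 / sqrt (1 - u) * (u / 4) ^ n)) \<partial>lborel)"
    by (subst nn_integral_real_affine[where c = "1/4" and t = 0]) auto
  \<comment> \<open>The unsimplified exponents match the Beta integral with parameters
    \<open>real n + 1\<close> and \<open>1/2\<close>.\<close>
  also have "\<dots> = ennreal (1/4) * (\<integral>\<^sup>+ u. ennreal ((1/4) ^ n) *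
       ennreal (indicator {0<..<1} u * (u powr (real n + 1 - 1) * (1 - u) powr (1/2 - 1))) \<partial>lborel)"
    by (intro arg_cong[where f = "\<lambda>z. _ * z"] nn_integral_cong)
       (auto simp: indicator_def powr_realpow powr_minus powr_half_sqrt ennreal_mult' [symmetric]
          power_divide field_simps)
  also have "\<dots> = ennreal (1/4) * (ennreal ((1/4) ^ n) * ennreal (Beta (real n + 1) (1/2)))"
  proof -
    have "((\<lambda>u. u powr (real n + 1 - 1) * (1 - u) powr (1/2 - 1)) has_integral Beta (real n + 1) (1/2)) {0<..<1}"
      using has_integral_Beta_real[of "real n + 1" "1/2"] by (simp add: has_integral_Icc_iff_Ioo)
    then have "((\<lambda>u. indicator {0<..<1} u * (u powr (real n + 1 - 1) * (1 - u) powr (1/2 - 1)))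
        has_integral Beta (real n + 1) (1/2)) UNIV"
      by (subst (asm) has_integral_restrict_UNIV [symmetric]) (simp add: indicator_def of_bool_def if_distribR if_distrib cong: if_cong)
    then show ?thesis
      by (subst nn_integral_cmult, simp, subst nn_integral_has_integral_lborel) auto
  qed
  also have "\<dots> = ennreal (1/4 * ((1/4) ^ n * Beta (real n + 1) (1/2)))"
    by (simp add: ennreal_mult' [symmetric])
  also have "1/4 * ((1/4) ^ n * Beta (real n + 1) (1/2)) = inverse (real ((2 * Suc n) choose Suc n)) / real (Suc n)"
    unfolding Beta_half_central_binomial by (simp add: field_simps power_divide del: binomial_Suc_Suc of_nat_Suc)
  finally show ?thesis .
qed

text \<open>Pascal's rule splits the next central binomial into two terms, each at least the current
  one. This crude growth already gives geometric domination of the weighted series.\<close>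

lemma two_power_le_central_binomial: "2 ^ n \<le> (2 * n) choose n"
proof (induction n)
  case (Suc n)
  have "(2 * n) choose n \<le> (Suc (2 * n)) choose n"
    by (cases n) auto
  moreover have "(2 * Suc n) choose Suc n = (Suc (2 * n) choose n) + (Suc (2 * n) choose Suc n)"
    by simp
  moreover have "(2 * n) choose n \<le> (Suc (2 * n)) choose Suc n"
    by simp
  ultimately show ?case using Suc by simp
qed simp

lemma summable_word_coeff_central_binomial:
  "summable (\<lambda>n. word_coeff w n * inverse (real ((2 * n) choose n)))"
proof (rule summable_comparison_test)
  show "summable (\<lambda>n. (1/2 :: real) ^ n)"
    by (simp add: summable_geometric)
  have "word_coeff w n * inverse (real ((2 * n) choose n)) \<le> 1 * inverse (2 ^ n)" for n
  proof (intro mult_mono word_coeff_le_1 le_imp_inverse_le)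
    show "2 ^ n \<le> real ((2 * n) choose n)"
      using two_power_le_central_binomial[of n] by (metis of_nat_le_iff of_nat_numeral of_nat_power)
  qed auto
  then show "\<exists>N. \<forall>n\<ge>N. norm (word_coeff w n * inverse (real ((2 * n) choose n))) \<le> (1/2) ^ n"
    by (simp add: abs_mult word_coeff_nonneg power_divide inverse_eq_divide)
qed

section \<open>Sums over decreasing tuples\<close>

text \<open>These are the possible tails of a decreasing tuple with head \<open>n\<close>; unlike
  \<open>decreasing_tuples r\<close>, they form a finite set.\<close>

definition tuples_below :: "nat \<Rightarrow> nat \<Rightarrow> nat list set" where
  "tuples_below r n = {l \<in> decreasing_tuples r. \<forall>x\<in>set l. x < n}"

lemma finite_tuples_below: "finite (tuples_below r n)"
  by (rule finite_subset[OF _ finite_lists_length_eq[of "{..<n}" r]])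
     (auto simp: tuples_below_def decreasing_tuples_def)

lemma tuples_below_0: "tuples_below 0 n = {[]}"
  by (auto simp: tuples_below_def decreasing_tuples_def)

lemma decreasing_tuples_Suc:
  "decreasing_tuples (Suc r) = (\<lambda>(m, l). m # l) ` (SIGMA m:{0<..}. tuples_below r m)"
  by (auto simp: tuples_below_def decreasing_tuples_def length_Suc_conv image_iff)

lemma tuples_below_Suc:
  "tuples_below (Suc r) n = (\<lambda>(m, l). m # l) ` (SIGMA m:{0<..<n}. tuples_below r m)"
  by (auto simp: tuples_below_def decreasing_tuples_def length_Suc_conv image_iff) (meson less_trans)

lemma inj_Cons_pair: "inj_on (\<lambda>(m, l). m # l) A"
  by (auto simp: inj_on_def)

definition tuple_prod :: "nat list \<Rightarrow> nat list \<Rightarrow> real" where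
  "tuple_prod a n = (\<Prod>i<length a. inverse (real (n ! i) ^ (a ! i)))"

lemma tuple_prod_Cons: "tuple_prod (b # a) (m # l) = inverse (real m ^ b) * tuple_prod a l"
  unfolding tuple_prod_def by (simp only: length_Cons prod.lessThan_Suc_shift) simp

lemma word_coeff_replicate_0: "word_coeff (replicate k 0 @ w) n = word_coeff w n / real n ^ k"
  by (induction k) (auto simp: field_simps)

text \<open>In the block of \<open>b\<close>, the letter 1 takes the partial sum and divides by
  \<open>n\<close> once; the \<open>b - 1\<close> zeros before it supply the other
  divisions.\<close>

lemma word_coeff_binary_word_Cons:
  assumes "0 < b"
  shows "word_coeff (binary_word (b # a)) n = (\<Sum>m<n. word_coeff (binary_word a) m) / real n ^ b"
  using assms by (cases b) (auto simp: binary_word_def word_coeff_replicate_0 field_simps)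

text \<open>Induction on \<open>a\<close>, splitting each tuple into its largest entry
  \<open>m\<close> and a tail below \<open>m\<close>. Positivity of \<open>n\<close> enters for the
  empty composition, whose only nonzero coefficient is at 0 and must be counted.\<close>

lemma sum_word_coeff_binary_word:
  assumes "composition a" "0 < n"
  shows "(\<Sum>m<n. word_coeff (binary_word a) m) = (\<Sum>l\<in>tuples_below (length a) n. tuple_prod a l)"
  using assms
proof (induction a arbitrary: n)
  case Nil
  then show ?case
    by (simp add: binary_word_def tuples_below_0 tuple_prod_def of_bool_def sum.delta)
next
  case (Cons b a)
  have b: "0 < b" "composition a"
    using Cons.prems by (auto simp: composition_def)
  have "(\<Sum>l\<in>tuples_below (length (b # a)) n. tuple_prod (b # a) l)
     = (\<Sum>(m, l)\<in>(SIGMA m:{0<..<n}. tuples_below (length a) m). inverse (real m ^ b) * tuple_prod a l)"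
    unfolding length_Cons tuples_below_Suc
    by (subst sum.reindex[OF inj_Cons_pair]) (auto simp: tuple_prod_Cons intro!: sum.cong)
  also have "\<dots> = (\<Sum>m\<in>{0<..<n}. \<Sum>l\<in>tuples_below (length a) m. inverse (real m ^ b) * tuple_prod a l)"
    by (rule sum.Sigma [symmetric]) (auto simp: finite_tuples_below)
  also have "\<dots> = (\<Sum>m\<in>{0<..<n}. word_coeff (binary_word (b # a)) m)"
    using b Cons.IH
    by (intro sum.cong) (auto simp: word_coeff_binary_word_Cons divide_inverse sum_distrib_left mult_ac)
  \<comment> \<open>The additional term \<open>m = 0\<close> vanishes because \<open>b\<close> is
    positive and division by zero gives 0.\<close>
  also have "\<dots> = (\<Sum>m<n. word_coeff (binary_word (b # a)) m)"
    using b by (intro sum.mono_neutral_left) (auto simp: word_coeff_binary_word_Cons)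
  finally show ?case by simp
qed

text \<open>The tuples are grouped by their largest entry \<open>m\<close>. Each group is finite and
  sums to the coefficient at \<open>m\<close> times the binomial weight.\<close>

lemma has_sum_sigma_summand:
  assumes "composition (b # a)"
  shows "(sigma_summand (b # a) has_sum
           (\<Sum>n. word_coeff (binary_word (b # a)) n * inverse (real ((2 * n) choose n))))
         (decreasing_tuples (Suc (length a)))"
proof -
  let ?g = "\<lambda>n. word_coeff (binary_word (b # a)) n * inverse (real ((2 * n) choose n))"
  let ?S = "SIGMA m:{0<..}. tuples_below (length a) m"
  let ?f = "\<lambda>(m, l). sigma_summand (b # a) (m # l)"
  have b: "0 < b" "composition a"
    using assms by (auto simp: composition_def)
  have summand: "sigma_summand (b # a) (m # l) =
      inverse (real ((2 * m) choose m)) * (inverse (real m ^ b) * tuple_prod a l)" for m l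
    unfolding sigma_summand_def tuple_prod_def [symmetric] tuple_prod_Cons by simp
  have inner: "((\<lambda>l. ?f (m, l)) has_sum ?g m) (tuples_below (length a) m)" if "m \<in> {0<..}" for m
    using that b sum_word_coeff_binary_word[of a m]
    by (intro has_sum_finiteI finite_tuples_below)
       (simp add: summand word_coeff_binary_word_Cons divide_inverse sum_distrib_left sum_distrib_right mult_ac)
  have "(?g has_sum (\<Sum>n. ?g n)) UNIV"
    by (intro sums_nonneg_imp_has_sum summable_sums summable_word_coeff_central_binomial
          mult_nonneg_nonneg word_coeff_nonneg) auto
  then have outer: "(?g has_sum (\<Sum>n. ?g n)) {0<..}"
    by (subst (asm) has_sum_cong_neutral[of _ UNIV ?g ?g]) (auto simp: word_coeff_binary_word_Cons b)
  \<comment> \<open>Nonnegativity turns summability of the group sums into summability over all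
    pairs.\<close>
  have "?f summable_on ?S"
  proof (rule summable_on_SigmaI)
    show "((\<lambda>l. ?f (m, l)) has_sum ?g m) (tuples_below (length a) m)" if "m \<in> {0<..}" for m
      using inner[OF that] .
    show "?g summable_on {0<..}"
      using outer by (auto simp: summable_on_def)
  qed (auto simp: summand tuple_prod_def intro!: mult_nonneg_nonneg prod_nonneg)
  then have "(?f has_sum (\<Sum>n. ?g n)) ?S"
    by (intro has_sum_SigmaI[where g = ?g] inner outer)
  then show ?thesis
    unfolding decreasing_tuples_Suc
    by (subst has_sum_reindex[OF inj_Cons_pair]) (simp add: o_def case_prod_beta')
qed

section \<open>Binary words and the integral formula\<close>

lemma ends_in_one_append: "ends_in_one v \<Longrightarrow> ends_in_one (replicate k 0 @ 1 # v)"
  by (induction k) auto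

lemma ends_in_one_binary_word: "ends_in_one (binary_word a)"
  by (induction a) (auto simp: binary_word_def dest: ends_in_one_append)

theorem theorem1:
  fixes a :: "nat list"
  assumes "composition a" and "a \<noteq> []"
  shows "sigma_summand a summable_on decreasing_tuples (length a) \<and>
    set_integrable (lborel_pow (weight a)) (simplex_quarter (weight a))
      (sigma_integrand (binary_word a)) \<and>
    comp_sigma a = (LINT t:simplex_quarter (weight a)|lborel_pow (weight a).
      sigma_integrand (binary_word a) t)"
proof -
  let ?k = "weight a"
  \<comment> \<open>The common value of the sum over tuples and the integral over the
    simplex.\<close>
  define s where "s = (\<Sum>n. word_coeff (binary_word a) n * inverse (real ((2 * n) choose n)))"
  have s0: "0 \<le> s"
    unfolding s_def
    by (intro suminf_nonneg summable_word_coeff_central_binomial mult_nonneg_nonneg word_coeff_nonneg) auto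
  have has_sum: "(sigma_summand a has_sum s) (decreasing_tuples (length a))"
    using assms has_sum_sigma_summand by (cases a) (auto simp: s_def)
  have len: "length (binary_word a) = ?k"
    using assms(1) by (rule length_binary_word)
  obtain e w where ew: "binary_word a = e # w"
    using assms(2) by (cases a; cases "binary_word a") (auto simp: binary_word_def)
  have good: "e = 0 \<longrightarrow> w \<noteq> []" "ends_in_one w"
    using ends_in_one_binary_word[of a] by (auto simp: ew)
  \<comment> \<open>The square root weight is absorbed into the outermost letter, making the
    integrand a pure product of one-variable functions.\<close>
  define gs where "gs = (\<lambda>t. 1 / sqrt (1 - 4 * t) * f_letter e t) # map f_letter w"
  have k: "length gs = ?k"
    using len by (simp add: gs_def ew)
  have integrand: "indicat_real (simplex_quarter ?k) t *\<^sub>R sigma_integrand (binary_word a) t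
      = of_bool (decreasing_below {0..<?k} (1/4) t) * (\<Prod>i\<in>{0..<?k}. (gs ! i) (t i))"
    if "t \<in> space (lborel_pow ?k)" for t
  proof -
    have "t \<in> simplex_quarter ?k \<longleftrightarrow> decreasing_below {0..<?k} (1/4) t"
      using that by (force simp: simplex_quarter_def decreasing_below_def)
    moreover have "sigma_integrand (binary_word a) t = (\<Prod>i\<in>{0..<?k}. (gs ! i) (t i))"
    proof -
      have "(\<Prod>i\<in>{0..<?k}. (gs ! i) (t i)) = (gs ! 0) (t 0) * (\<Prod>i\<in>{1..<?k}. (gs ! i) (t i))"
        using k by (subst prod.atLeast_Suc_lessThan) (auto simp: gs_def)
      also have "(\<Prod>i\<in>{1..<?k}. (gs ! i) (t i)) = (\<Prod>i\<in>{1..<?k}. f_letter (binary_word a ! i) (t i))"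
        using len by (intro prod.cong) (auto simp: gs_def ew nth_Cons')
      finally show ?thesis
        unfolding sigma_integrand_def len by (simp add: gs_def ew)
    qed
    ultimately show ?thesis by (auto simp: indicator_def)
  qed
  have gs_meas: "g \<in> borel_measurable borel" if "g \<in> set gs" for g
    using that by (auto simp: gs_def)
  have gs_nonneg: "0 \<le> g y" if "g \<in> set gs" "0 < y" "y < 1/4" for g y
    using that by (auto simp: gs_def f_letter_nonneg)
  let ?F = "\<lambda>t. indicat_real (simplex_quarter ?k) t *\<^sub>R sigma_integrand (binary_word a) t"
  have "(\<integral>\<^sup>+ t. ennreal (?F t) \<partial>lborel_pow ?k) =
     (\<integral>\<^sup>+ t. ennreal (of_bool (decreasing_below {0..<?k} (1/4) t) * (\<Prod>i\<in>{0..<?k}. (gs ! i) (t i)))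
        \<partial>lborel_pow ?k)"
    by (intro nn_integral_cong) (simp only: integrand)
  also have "\<dots> = iter_int gs (1/4)"
    using nn_integral_simplex_eq_iter_int[of gs 0 "1/4" "1/4"] gs_meas gs_nonneg
    by (simp add: k lborel_pow_def atLeast0LessThan)
  \<comment> \<open>The weighted step at \<open>x = 1/4\<close> for the first letter; the remaining
    letters have their ordinary power series.\<close>
  also have "\<dots> = ennreal s"
    unfolding gs_def s_def ew
    by (intro iter_int_weighted_letter nn_integral_central_binomial_weight iter_int_letters good
          summable_word_coeff_central_binomial) auto
  finally have nn: "(\<integral>\<^sup>+ t. ennreal (?F t) \<partial>lborel_pow ?k) = ennreal s" .
  have meas: "?F \<in> borel_measurable (lborel_pow ?k)"
  proof -
    have [measurable]: "(\<lambda>t. (gs ! i) (t i)) \<in> borel_measurable (\<Pi>\<^sub>M i\<in>{0..<?k}. lborel)"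
      if "i \<in> {0..<?k}" for i
      using that measurable_component_singleton[OF that, of "\<lambda>_. lborel :: real measure"] k
      by (intro measurable_compose[OF _ gs_meas[OF nth_mem]]) auto
    have "(\<lambda>t. of_bool (decreasing_below {0..<?k} (1/4) t) * (\<Prod>i\<in>{0..<?k}. (gs ! i) (t i)))
       \<in> borel_measurable (\<Pi>\<^sub>M i\<in>{0..<?k}. lborel)"
      by measurable
    then show ?thesis
      using integrand by (subst measurable_cong) (auto simp: lborel_pow_def atLeast0LessThan)
  qed
  have "AE t in lborel_pow ?k. 0 \<le> ?F t"
  proof (rule AE_I2)
    fix t assume "t \<in> space (lborel_pow ?k)"
    then show "0 \<le> ?F t"
      using k unfolding integrand[OF \<open>t \<in> _\<close>]
      by (auto simp: decreasing_below_def intro!: prod_nonneg gs_nonneg[OF nth_mem])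
  qed
  \<comment> \<open>For a nonnegative measurable function, a finite \<open>nn_integral\<close> gives
    both integrability and the value of the integral.\<close>
  with nn meas s0 have "integrable (lborel_pow ?k) ?F \<and> integral\<^sup>L (lborel_pow ?k) ?F = s"
    using nn_integral_eq_integrable by blast
  with has_sum show ?thesis
    unfolding set_integrable_def set_lebesgue_integral_def comp_sigma_def
    by (auto simp: summable_on_def infsumI)
qed

end
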